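(* Let $V$ be a vector space of finite dimension $n\ge 2$ over a field $\mathbb{F}$, endowed with a symplectic form of maximal rank. Then the pre-geometry $\Gamma=\Gamma(V)$ is a geometry with a string diagram.
   Context: For $U\le V$ let $U^\perp$ be its orthogonal with respect to the form and $\mathrm{Rad}(U)=U\cap U^\perp$. Maximal rank means $\dim\mathrm{Rad}(V)=0$ if $n$ is even and $1$ if $n$ is odd. $\Gamma(V)$ has type set $I=\{1,\dots,n-1\}$. Its objects of type $i$ are the $i$-dimensional subspaces $U\le V$ with $U\cap\mathrm{Rad}(V)=0$ and $\dim\mathrm{Rad}(U)\le 1$. Each object is incident with itself, and objects $X,Y$ with $\dim X<\dim Y$ are incident iff $X\subseteq Y$ and $X\cap\mathrm{Rad}(Y)=0$. Distinct objects of equal dimension are not incident. A flag is a (possibly empty) set of pairwise incident objects; a chamber is a flag containing an object of every type in $I$. A pre-geometry over $I$ is a geometry if every type in $I$ occurs as the type of an object and it is transversal, i.e. every flag is contained in a chamber. A geometry has a string diagram if there is a total ordering on $I$ such that for any types $i<j<k$ and objects $X,Y,Z$ of types $i,j,k$ respectively, if $X$ and $Z$ are both incident with $Y$, then $X$ is incident with $Z$. *)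

theory Defs
  imports Complex_Main
begin

record ('i, 'o) incidence_structure =
  type_set :: "'i set"
  objects :: "'o set"
  type_of :: "'o \<Rightarrow> 'i"
  incident :: "'o \<Rightarrow> 'o \<Rightarrow> bool"

definition pregeometry :: "('i, 'o) incidence_structure \<Rightarrow> bool" where
  "pregeometry G \<longleftrightarrow>
     (\<forall>X\<in>objects G. type_of G X \<in> type_set G) \<and>
     (\<forall>X\<in>objects G. incident G X X) \<and>
     (\<forall>X\<in>objects G. \<forall>Y\<in>objects G. incident G X Y \<longrightarrow> incident G Y X) \<and>
     (\<forall>X\<in>objects G. \<forall>Y\<in>objects G.
        incident G X Y \<and> type_of G X = type_of G Y \<longrightarrow> X = Y)"

definition flag :: "('i, 'o) incidence_structure \<Rightarrow> 'o set \<Rightarrow> bool" where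
  "flag G F \<longleftrightarrow> F \<subseteq> objects G \<and> (\<forall>X\<in>F. \<forall>Y\<in>F. incident G X Y)"

definition chamber :: "('i, 'o) incidence_structure \<Rightarrow> 'o set \<Rightarrow> bool" where
  "chamber G C \<longleftrightarrow> flag G C \<and> (\<forall>i\<in>type_set G. \<exists>X\<in>C. type_of G X = i)"

definition transversal :: "('i, 'o) incidence_structure \<Rightarrow> bool" where
  "transversal G \<longleftrightarrow> (\<forall>F. flag G F \<longrightarrow> (\<exists>C. chamber G C \<and> F \<subseteq> C))"

definition geometry :: "('i, 'o) incidence_structure \<Rightarrow> bool" where
  "geometry G \<longleftrightarrow>
     pregeometry G \<and>
     (\<forall>i\<in>type_set G. \<exists>X\<in>objects G. type_of G X = i) \<and>
     transversal G"

text \<open>The total ordering on the types is arbitrary; it is given by its reflexive relation \<open>r\<close>,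
  whose strict part is used to compare types.\<close>

definition has_string_diagram :: "('i, 'o) incidence_structure \<Rightarrow> bool" where
  "has_string_diagram G \<longleftrightarrow>
     (\<exists>r. linear_order_on (type_set G) r \<and>
       (\<forall>X\<in>objects G. \<forall>Y\<in>objects G. \<forall>Z\<in>objects G.
          (type_of G X, type_of G Y) \<in> r \<and> type_of G X \<noteq> type_of G Y \<and>
          (type_of G Y, type_of G Z) \<in> r \<and> type_of G Y \<noteq> type_of G Z \<and>
          incident G X Y \<and> incident G Z Y \<longrightarrow> incident G X Z))"

text \<open>A symplectic form is an alternating bilinear form, in any characteristic; it may be degenerate.\<close>

definition symplectic_form ::
  "('f::field \<Rightarrow> 'v::ab_group_add \<Rightarrow> 'v) \<Rightarrow> ('v \<Rightarrow> 'v \<Rightarrow> 'f) \<Rightarrow> bool" where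
  "symplectic_form scale B \<longleftrightarrow>
     (\<forall>y. Vector_Spaces.linear scale (*) (\<lambda>x. B x y)) \<and>
     (\<forall>x. Vector_Spaces.linear scale (*) (\<lambda>y. B x y)) \<and>
     (\<forall>x. B x x = 0)"

definition perp :: "('v \<Rightarrow> 'v \<Rightarrow> 'f::zero) \<Rightarrow> 'v set \<Rightarrow> 'v set" where
  "perp B U = {v. \<forall>u\<in>U. B u v = 0}"

definition Rad :: "('v \<Rightarrow> 'v \<Rightarrow> 'f::zero) \<Rightarrow> 'v set \<Rightarrow> 'v set" where
  "Rad B U = U \<inter> perp B U"

definition maximal_rank ::
  "('f::field \<Rightarrow> 'v::ab_group_add \<Rightarrow> 'v) \<Rightarrow> ('v \<Rightarrow> 'v \<Rightarrow> 'f) \<Rightarrow> bool" where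
  "maximal_rank scale B \<longleftrightarrow>
     vector_space.dim scale (Rad B UNIV) =
       (if even (vector_space.dim scale (UNIV :: 'v set)) then 0 else 1)"

definition Gamma_objects ::
  "('f::field \<Rightarrow> 'v::ab_group_add \<Rightarrow> 'v) \<Rightarrow> ('v \<Rightarrow> 'v \<Rightarrow> 'f) \<Rightarrow> 'v set set" where
  "Gamma_objects scale B =
     {U. module.subspace scale U \<and>
         vector_space.dim scale U \<in> {1..vector_space.dim scale (UNIV :: 'v set) - 1} \<and>
         U \<inter> Rad B UNIV = {0} \<and>
         vector_space.dim scale (Rad B U) \<le> 1}"

definition Gamma_incident ::
  "('f::field \<Rightarrow> 'v::ab_group_add \<Rightarrow> 'v) \<Rightarrow> ('v \<Rightarrow> 'v \<Rightarrow> 'f) \<Rightarrow> 'v set \<Rightarrow> 'v set \<Rightarrow> bool" where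
  "Gamma_incident scale B X Y \<longleftrightarrow>
     X = Y \<or>
     (vector_space.dim scale X < vector_space.dim scale Y \<and> X \<subseteq> Y \<and> X \<inter> Rad B Y = {0}) \<or>
     (vector_space.dim scale Y < vector_space.dim scale X \<and> Y \<subseteq> X \<and> Y \<inter> Rad B X = {0})"

definition Gamma ::
  "('f::field \<Rightarrow> 'v::ab_group_add \<Rightarrow> 'v) \<Rightarrow> ('v \<Rightarrow> 'v \<Rightarrow> 'f)
     \<Rightarrow> (nat, 'v set) incidence_structure" where
  "Gamma scale B =
     \<lparr>type_set = {1..vector_space.dim scale (UNIV :: 'v set) - 1},
      objects = Gamma_objects scale B,
      type_of = vector_space.dim scale,
      incident = Gamma_incident scale B\<rparr>"

end

theory Submission
  imports Defs
begin

text \<open>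
  For subspaces say that \<open>X\<close> precedes \<open>Y\<close> if \<open>dim X < dim Y\<close>, \<open>X \<subseteq> Y\<close> and
  \<open>X \<inter> Rad Y = 0\<close>. Two observations make the theorem work.

  First, \<open>precedes\<close> is transitive, since \<open>X \<subseteq> Y\<close> gives \<open>X \<inter> Rad Z \<subseteq> Y \<inter> Rad Z = 0\<close>.
  So the usual order of the dimensions is a string diagram. Moreover the objects of the geometry are
  the subspaces with radical of dimension at most one that lie strictly between \<open>0\<close> and \<open>V\<close> with
  respect to \<open>precedes\<close>. Maximal rank says that \<open>V\<close> itself has such a radical, so that
  \<open>0\<close> and \<open>V\<close> can be treated as the end points of every flag.

  Second, a gap in a flag can be filled one dimension at a time (lemma \<open>precedes_refine\<close>): if
  \<open>X\<close> precedes \<open>Y\<close> and \<open>dim Y > dim X + 1\<close>, a vector \<open>v \<in> Y - (X + Rad Y)\<close> can be chosen such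
  that \<open>Z = X + \<langle>v\<rangle>\<close> lies between \<open>X\<close> and \<open>Y\<close> for \<open>precedes\<close>; its radical
  meets the hyperplane \<open>X\<close> trivially and so has dimension at most one. If \<open>X\<close> is nondegenerate, every such \<open>v\<close>
  works. If \<open>Rad X = \<langle>x\<rangle>\<close>, then \<open>v\<close> must not be orthogonal to \<open>x\<close>; such a \<open>v \<in> Y\<close> exists
  because \<open>x \<notin> Rad Y\<close>, and it avoids \<open>X + Rad Y\<close> because \<open>x\<close> is orthogonal to that sum.
  Filling all gaps of a flag gives a chamber; starting from the empty flag, it also shows that every
  type occurs.
\<close>

locale alternating_space = finite_dimensional_vector_space scale Basis
  for scale :: "'f::field \<Rightarrow> 'v::ab_group_add \<Rightarrow> 'v" (infixr \<open>*s\<close> 75)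
    and Basis :: "'v set" +
  fixes B :: "'v \<Rightarrow> 'v \<Rightarrow> 'f"
  assumes symplectic: "symplectic_form scale B"
begin

section \<open>Radicals\<close>

lemma form_add_left: "B (x + y) z = B x z + B y z"
  and form_add_right: "B z (x + y) = B z x + B z y"
  and form_scale_left: "B (c *s x) z = c * B x z"
  and form_scale_right: "B z (c *s x) = c * B z x"
  and form_self: "B x x = 0"
  using symplectic unfolding symplectic_form_def Vector_Spaces.linear_iff by auto

lemma form_zero_right: "B z 0 = 0"
  using form_scale_right[of z 0 0] by simp

lemma form_skew: "B y x = - B x y"
proof -
  have "B (x + y) (x + y) = B x y + B y x"
    unfolding form_add_left form_add_right by (simp add: form_self)
  then show ?thesis
    by (simp add: form_self eq_neg_iff_add_eq_0 add.commute)
qed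

lemma subspace_Rad: "subspace U \<Longrightarrow> subspace (Rad B U)"
  unfolding Rad_def perp_def subspace_def
  by (auto simp: form_add_right form_scale_right form_zero_right)

lemma subspace_span_insert_decompose:
  assumes "subspace X" "z \<in> span (insert v X)"
  obtains k u where "u \<in> X" "z = u + k *s v"
proof -
  have "span X = X" using assms(1) by (rule span_eq_iff[THEN iffD2])
  with assms(2) obtain k where "z - k *s v \<in> X"
    by (auto simp: span_breakdown_eq simp del: span_eq_iff)
  then show ?thesis using that[of "z - k *s v" k] by simp
qed

text \<open>The radical of \<open>Z\<close> meets the hyperplane \<open>X\<close> trivially, so it is at most a line.\<close>

lemma dim_Rad_le_1_if_hyperplane:
  assumes "subspace X" "subspace Z" "X \<subseteq> Z" "dim Z \<le> dim X + 1" "X \<inter> Rad B Z \<subseteq> {0}"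
  shows "dim (Rad B Z) \<le> 1"
proof -
  let ?S = "{x + y |x y. x \<in> X \<and> y \<in> Rad B Z}"
  have "dim ?S + dim (X \<inter> Rad B Z) = dim X + dim (Rad B Z)"
    using assms by (intro dim_sums_Int subspace_Rad)
  moreover have "?S \<subseteq> Z"
    using assms(2,3) by (auto simp: Rad_def intro!: subspace_add)
  ultimately show ?thesis
    using dim_subset[of ?S Z] assms(4) dim_eq_0[of "X \<inter> Rad B Z"] assms(5) by linarith
qed

section \<open>The order underlying incidence\<close>

definition precedes :: "'v set \<Rightarrow> 'v set \<Rightarrow> bool" where
  "precedes X Y \<longleftrightarrow> dim X < dim Y \<and> X \<subseteq> Y \<and> X \<inter> Rad B Y = {0}"

definition almost_nondegenerate :: "'v set \<Rightarrow> bool" where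
  "almost_nondegenerate U \<longleftrightarrow> subspace U \<and> dim (Rad B U) \<le> 1"

lemma precedes_trans:
  assumes "precedes X Y" "precedes Y Z"
  shows "precedes X Z"
proof -
  have "0 \<in> X \<inter> Rad B Z" using assms unfolding precedes_def by blast
  then show ?thesis using assms unfolding precedes_def by auto
qed

lemma Gamma_incident_iff:
  "Gamma_incident scale B X Y \<longleftrightarrow> X = Y \<or> precedes X Y \<or> precedes Y X"
  unfolding Gamma_incident_def precedes_def by simp

text \<open>The bounds on the dimension of an object and its trivial intersection with \<open>Rad V\<close> are comparisons with the two trivial
  subspaces, which makes flags together with \<open>0\<close> and \<open>V\<close> chains for \<open>precedes\<close>.\<close>

lemma Gamma_objects_iff:
  "U \<in> Gamma_objects scale B \<longleftrightarrow>
     almost_nondegenerate U \<and> precedes {0} U \<and> precedes U UNIV"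
proof (cases "subspace U")
  case True
  then have "0 \<in> U" "0 \<in> Rad B U" by (auto intro: subspace_0 subspace_Rad)
  then show ?thesis
    unfolding Gamma_objects_def almost_nondegenerate_def precedes_def by auto
next
  case False
  then show ?thesis unfolding Gamma_objects_def almost_nondegenerate_def by simp
qed

text \<open>If \<open>X\<close> is nondegenerate, any vector of \<open>Y\<close> outside \<open>X + Rad Y\<close> will do; it exists because that
  sum has dimension at most \<open>dim X + 1\<close>. If \<open>Rad X\<close> is spanned by \<open>x\<close>, then \<open>x\<close> is orthogonal to
  \<open>X + Rad Y\<close> but not to all of \<open>Y\<close>, so a vector of \<open>Y\<close> not orthogonal to \<open>x\<close> has all properties.
  The last one says that no nonzero vector of \<open>Rad X\<close> survives in the radical of
  \<open>X + \<langle>v\<rangle>\<close>.\<close>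

lemma exists_extending_vector:
  assumes X: "almost_nondegenerate X" and Y: "almost_nondegenerate Y"
    and XY: "precedes X Y" and gap: "dim X + 1 < dim Y"
  obtains v where "v \<in> Y" "\<And>u r. u \<in> X \<Longrightarrow> r \<in> Rad B Y \<Longrightarrow> v \<noteq> u + r"
    "\<And>x. x \<in> Rad B X \<Longrightarrow> B x v = 0 \<Longrightarrow> x = 0"
proof (cases "Rad B X \<subseteq> {0}")
  case True
  let ?S = "{u + r |u r. u \<in> X \<and> r \<in> Rad B Y}"
  have "dim ?S + dim (X \<inter> Rad B Y) = dim X + dim (Rad B Y)"
    using X Y unfolding almost_nondegenerate_def by (intro dim_sums_Int subspace_Rad) auto
  then have "dim ?S < dim Y"
    using gap Y unfolding almost_nondegenerate_def by linarith
  then have "\<not> Y \<subseteq> ?S" using dim_subset[of Y ?S] by linarith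
  then show ?thesis using that True by blast
next
  case False
  then obtain x where x: "x \<in> Rad B X" "x \<noteq> 0" by auto
  then have "x \<notin> Rad B Y" "x \<in> Y"
    using XY unfolding precedes_def Rad_def by auto
  then obtain v where v: "v \<in> Y" "B v x \<noteq> 0"
    unfolding Rad_def perp_def by auto
  have xv: "B x v \<noteq> 0" using v(2) form_skew[of v x] by simp
  have "v \<noteq> u + r" if "u \<in> X" "r \<in> Rad B Y" for u r
  proof
    assume "v = u + r"
    moreover have "B u x = 0" using that(1) x(1) unfolding Rad_def perp_def by auto
    moreover have "B x r = 0" using that(2) \<open>x \<in> Y\<close> unfolding Rad_def perp_def by auto
    ultimately show False
      using v(2) form_skew[of r x] by (simp add: form_add_left)
  qed
  moreover have "y = 0" if "y \<in> Rad B X" "B y v = 0" for y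
  proof -
    have "dim {x} \<ge> dim (Rad B X)" using X x(2) unfolding almost_nondegenerate_def by simp
    then have "span {x} = span (Rad B X)"
      using x(1) by (intro dim_eq_span) auto
    then have "y \<in> span {x}" using that(1) span_base by blast
    then obtain k where "y = k *s x" by (auto simp: span_singleton)
    then show ?thesis using that(2) xv by (simp add: form_scale_left)
  qed
  ultimately show ?thesis using that v(1) by blast
qed

lemma precedes_refine:
  assumes X: "almost_nondegenerate X" and Y: "almost_nondegenerate Y"
    and XY: "precedes X Y" and gap: "dim X + 1 < dim Y"
  obtains Z where "almost_nondegenerate Z" "dim Z = dim X + 1" "precedes X Z" "precedes Z Y"
proof -
  obtain v where v: "v \<in> Y"
    and v_sum: "\<And>u r. u \<in> X \<Longrightarrow> r \<in> Rad B Y \<Longrightarrow> v \<noteq> u + r"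
    and v_Rad: "\<And>x. x \<in> Rad B X \<Longrightarrow> B x v = 0 \<Longrightarrow> x = 0"
    using exists_extending_vector[OF assms] by metis
  have subX: "subspace X" and subY: "subspace Y"
    using X Y unfolding almost_nondegenerate_def by auto
  note subRadY = subspace_Rad[OF subY]
  define Z where "Z = span (insert v X)"
  have subZ: "subspace Z" and vZ: "v \<in> Z" and XZ: "X \<subseteq> Z"
    unfolding Z_def by (auto intro: span_base)
  have ZY: "Z \<subseteq> Y"
    unfolding Z_def using v XY subY by (intro span_minimal) (auto simp: precedes_def)
  have "v \<notin> X" using v_sum[of v 0] subspace_0[OF subRadY] by auto
  moreover have "span X = X" using subX by (rule span_eq_iff[THEN iffD2])
  ultimately have dimZ: "dim Z = dim X + 1"
    unfolding Z_def by (simp add: dim_insert del: span_eq_iff)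
  have "x = 0" if "x \<in> X \<inter> Rad B Z" for x
  proof (rule v_Rad)
    show "x \<in> Rad B X" using that XZ unfolding Rad_def perp_def by auto
    have "B v x = 0" using that vZ unfolding Rad_def perp_def by auto
    then show "B x v = 0" using form_skew[of x v] by simp
  qed
  then have XRadZ: "X \<inter> Rad B Z = {0}"
    using subspace_0[OF subX] subspace_0[OF subspace_Rad[OF subZ]] by auto
  have "z = 0" if z: "z \<in> Z" "z \<in> Rad B Y" for z
  proof -
    obtain k u where u: "u \<in> X" "z = u + k *s v"
      using subspace_span_insert_decompose[OF subX] z(1) unfolding Z_def by blast
    \<comment> \<open>A nonzero coefficient would express \<open>v\<close> as a sum from \<open>X + Rad Y\<close>.\<close>
    have "k = 0"
    proof (rule ccontr)
      assume "k \<noteq> 0"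
      have "v = inverse k *s (k *s v)" using \<open>k \<noteq> 0\<close> by simp
      also have "k *s v = - u + z" using u(2) by simp
      also have "inverse k *s (- u + z) = inverse k *s (- u) + inverse k *s z"
        by (rule scale_right_distrib)
      finally show False
        using v_sum[of "inverse k *s (- u)" "inverse k *s z"] u(1) z(2) subX subRadY
        by (auto simp: subspace_scale subspace_neg)
    qed
    then have "z \<in> X \<inter> Rad B Y" using u z(2) by simp
    then show ?thesis using XY unfolding precedes_def by auto
  qed
  then have ZRadY: "Z \<inter> Rad B Y = {0}"
    using subspace_0[OF subZ] subspace_0[OF subRadY] by auto
  show ?thesis
  proof (rule that)
    show "almost_nondegenerate Z"
      unfolding almost_nondegenerate_def
      using dim_Rad_le_1_if_hyperplane[OF subX subZ XZ] dimZ XRadZ subZ by simp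
    show "dim Z = dim X + 1" by (rule dimZ)
    show "precedes X Z" unfolding precedes_def using dimZ XZ XRadZ by simp
    show "precedes Z Y" unfolding precedes_def using dimZ gap ZY ZRadY by simp
  qed
qed

section \<open>The pre-geometry of almost nondegenerate subspaces\<close>

lemma pregeometry_Gamma: "pregeometry (Gamma scale B)"
  unfolding pregeometry_def Gamma_def Gamma_objects_def Gamma_incident_def by auto

lemma has_string_diagram_Gamma: "has_string_diagram (Gamma scale B)"
proof -
  define r where
    "r = {(i, j). i \<in> type_set (Gamma scale B) \<and> j \<in> type_set (Gamma scale B) \<and> i \<le> j}"
  have order: "linear_order_on (type_set (Gamma scale B)) r"
    unfolding linear_order_on_def partial_order_on_def preorder_on_def refl_on_def trans_def
      antisym_def total_on_def r_def by auto
  have incident: "Gamma_incident scale B X Z"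
    if "dim X < dim Y" "dim Y < dim Z"
      "Gamma_incident scale B X Y" "Gamma_incident scale B Z Y" for X Y Z
  proof -
    have "precedes X Y" "precedes Y Z"
      using that unfolding Gamma_incident_iff by (auto simp: precedes_def)
    then show ?thesis using precedes_trans unfolding Gamma_incident_iff by blast
  qed
  show ?thesis
    unfolding has_string_diagram_def
  proof (intro exI[of _ r] conjI ballI impI order, elim conjE)
    fix X Y Z
    assume "(type_of (Gamma scale B) X, type_of (Gamma scale B) Y) \<in> r"
      "type_of (Gamma scale B) X \<noteq> type_of (Gamma scale B) Y"
      "(type_of (Gamma scale B) Y, type_of (Gamma scale B) Z) \<in> r"
      "type_of (Gamma scale B) Y \<noteq> type_of (Gamma scale B) Z"
      "incident (Gamma scale B) X Y" "incident (Gamma scale B) Z Y"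
    then show "incident (Gamma scale B) X Z"
      using incident[of X Y Z] by (simp add: Gamma_def r_def)
  qed
qed

text \<open>The missing dimension just above the first \<open>m\<close> is inserted between the member of dimension
  \<open>m\<close> and the next larger member, where \<open>0\<close> and \<open>V\<close> serve as additional members. By
  transitivity the new object is incident with the entire flag.\<close>

lemma flag_insert_next_type:
  assumes V: "almost_nondegenerate UNIV"
    and C: "flag (Gamma scale B) C"
    and low: "\<And>i. i \<in> {1..m} \<Longrightarrow> \<exists>X\<in>C. dim X = i"
    and m: "m + 1 < dim UNIV"
    and missing: "\<And>X. X \<in> C \<Longrightarrow> dim X \<noteq> m + 1"
  obtains Z where "flag (Gamma scale B) (insert Z C)" "dim Z = m + 1"
proof -
  define E where "E = insert {0} (insert UNIV C)"
  have C_obj: "W \<in> Gamma_objects scale B" if "W \<in> C" for W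
    using that C unfolding flag_def Gamma_def by auto
  have "dim (Rad B {0}) = 0" by (auto simp: Rad_def)
  then have zero: "almost_nondegenerate {0}"
    unfolding almost_nondegenerate_def by (simp del: dim_eq_0)
  have "precedes {0} UNIV"
    unfolding precedes_def using m subspace_0[OF subspace_Rad[OF subspace_UNIV]]
    by (auto simp del: dim_UNIV)
  then have E_incident: "Gamma_incident scale B X Y" if "X \<in> E" "Y \<in> E" for X Y
  proof -
    have "Gamma_incident scale B W W'" if "W \<in> C" "W' \<in> C" for W W'
      using that C unfolding flag_def Gamma_def by simp
    moreover have "precedes {0} W" "precedes W UNIV" if "W \<in> C" for W
      using C_obj[OF that] unfolding Gamma_objects_iff by simp_all
    ultimately show ?thesis
      using that \<open>precedes {0} UNIV\<close> unfolding Gamma_incident_iff E_def by blast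
  qed
  have E_almost: "almost_nondegenerate X" if "X \<in> E" for X
    using that zero V C_obj Gamma_objects_iff unfolding E_def by auto
  have E_precedes: "precedes X Y" if "X \<in> E" "Y \<in> E" "dim X < dim Y" for X Y
    using E_incident[OF that(1,2)] that(3) unfolding Gamma_incident_iff by (auto simp: precedes_def)
  obtain X where X: "X \<in> E" "dim X = m"
  proof (cases "m = 0")
    case True
    then show ?thesis using that[of "{0}"] by (simp add: E_def)
  next
    case False
    then show ?thesis using low[of m] that by (auto simp: E_def)
  qed
  obtain Y where Y: "Y \<in> E" "m + 1 < dim Y"
    and Y_least: "\<And>W. W \<in> E \<Longrightarrow> m + 1 < dim W \<Longrightarrow> dim Y \<le> dim W"
  proof -
    have "UNIV \<in> E \<and> m + 1 < dim UNIV" using m by (simp add: E_def)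
    from ex_has_least_nat[of "\<lambda>W. W \<in> E \<and> m + 1 < dim W", OF this, of dim]
    show ?thesis using that by blast
  qed
  have "precedes X Y" using E_precedes[OF X(1) Y(1)] X(2) Y(2) by simp
  then obtain Z where Z: "almost_nondegenerate Z" "dim Z = m + 1" "precedes X Z" "precedes Z Y"
    using precedes_refine[OF E_almost[OF X(1)] E_almost[OF Y(1)]] X(2) Y(2) by blast
  have Z_incident: "precedes W Z \<or> precedes Z W" if W: "W \<in> E" "dim W \<noteq> m + 1" for W
  proof (cases "dim W \<le> m")
    case True
    then have "W = X \<or> precedes W X"
      using E_incident[OF W(1) X(1)] X(2) unfolding Gamma_incident_iff by (auto simp: precedes_def)
    then show ?thesis using Z(3) precedes_trans by blast
  next
    case False
    then have "dim Y \<le> dim W" using Y_least W by simp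
    then have "W = Y \<or> precedes Y W"
      using E_incident[OF W(1) Y(1)] unfolding Gamma_incident_iff by (auto simp: precedes_def)
    then show ?thesis using Z(4) precedes_trans by blast
  qed
  have "Z \<in> Gamma_objects scale B"
  proof -
    have "precedes {0} Z \<or> precedes Z {0}" "precedes Z UNIV \<or> precedes UNIV Z"
      using Z_incident[of "{0}"] Z_incident[of UNIV] m by (auto simp: E_def)
    then show ?thesis
      unfolding Gamma_objects_iff using Z(1,2) m by (auto simp: precedes_def simp del: dim_UNIV)
  qed
  moreover have "Gamma_incident scale B Z W" "Gamma_incident scale B W Z" if "W \<in> C" for W
    using Z_incident[of W] missing[OF that] that unfolding Gamma_incident_iff E_def by auto
  ultimately have "flag (Gamma scale B) (insert Z C)"
    using C unfolding flag_def Gamma_def by (auto simp: Gamma_incident_iff)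
  then show ?thesis using that Z(2) by blast
qed

lemma flag_extends_to_types:
  assumes V: "almost_nondegenerate UNIV" and F: "flag (Gamma scale B) F"
    and "m < dim UNIV"
  shows "\<exists>C. flag (Gamma scale B) C \<and> F \<subseteq> C \<and> (\<forall>i\<in>{1..m}. \<exists>X\<in>C. dim X = i)"
  using assms(3)
proof (induction m)
  case 0
  then show ?case using F by auto
next
  case (Suc m)
  then obtain C where C: "flag (Gamma scale B) C" "F \<subseteq> C" "\<And>i. i \<in> {1..m} \<Longrightarrow> \<exists>X\<in>C. dim X = i"
    by (metis Suc_lessD)
  have types: "{1..Suc m} = insert (Suc m) {1..m}" by auto
  show ?case
  proof (cases "\<exists>X\<in>C. dim X = Suc m")
    case True
    then show ?thesis using C unfolding types by blast
  next
    case False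
    then obtain Z where "flag (Gamma scale B) (insert Z C)" "dim Z = Suc m"
      using flag_insert_next_type[OF V C(1) C(3)] Suc.prems by (metis Suc_eq_plus1)
    then show ?thesis using C(2,3) unfolding types by (intro exI[of _ "insert Z C"]) blast
  qed
qed

lemma geometry_Gamma:
  assumes V: "almost_nondegenerate UNIV" and "dim UNIV > 0"
  shows "geometry (Gamma scale B)"
proof -
  have extend: "\<exists>C. chamber (Gamma scale B) C \<and> F \<subseteq> C" if "flag (Gamma scale B) F" for F
    using flag_extends_to_types[OF V that, of "dim UNIV - 1"] assms(2)
    unfolding chamber_def by (auto simp: Gamma_def simp del: dim_UNIV)
  have "flag (Gamma scale B) {}" by (simp add: flag_def)
  then obtain C where "chamber (Gamma scale B) C" using extend by blast
  then have "\<forall>i\<in>type_set (Gamma scale B). \<exists>X\<in>objects (Gamma scale B). type_of (Gamma scale B) X = i"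
    unfolding chamber_def flag_def by blast
  then show ?thesis
    using pregeometry_Gamma extend unfolding geometry_def transversal_def by blast
qed

end

theorem corollary3p11:
  fixes scale :: "'f::field \<Rightarrow> 'v::ab_group_add \<Rightarrow> 'v"
    and Basis :: "'v set"
    and B :: "'v \<Rightarrow> 'v \<Rightarrow> 'f"
    and n :: nat
  assumes "finite_dimensional_vector_space scale Basis"
    and "vector_space.dim scale (UNIV :: 'v set) = n"
    and "n \<ge> 2"
    and "symplectic_form scale B"
    and "maximal_rank scale B"
  shows "geometry (Gamma scale B) \<and> has_string_diagram (Gamma scale B)"
proof -
  interpret alternating_space scale Basis B
    using assms(1,4) by (simp add: alternating_space_def alternating_space_axioms_def)
  have "almost_nondegenerate UNIV"
    using assms(5) unfolding maximal_rank_def almost_nondegenerate_def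
    by (simp split: if_splits)
  moreover have "dim UNIV > 0" using assms(2,3) by simp
  ultimately show ?thesis using geometry_Gamma has_string_diagram_Gamma by blast
qed

end
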